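(* Let $(f_n(q))_{n\ge 0}$ be polynomials and let $F(q)=\sum_{n=0}^{\infty}(q;q)_n f_n(q)$, understood via its expansions at roots of unity as described in the context. Let $\nu\in\{0,1\}$, let $a\ge 0$ and $b>0$ be integers, and let $\chi:\mathbb{Z}\to\mathbb{C}$ satisfy: (i) $\chi(n)\neq 0$ only if $\frac{n^2-a}{b}\in\mathbb{Z}$; (ii) for every root of unity $\zeta$, the function $n\mapsto \zeta^{\frac{n^2-a}{b}}\chi(n)$ is periodic with mean value zero. Put $P^{(\nu)}_{a,b,\chi}(q)=\sum_{n\ge 0} n^{\nu}\chi(n)q^{\frac{n^2-a}{b}}$. Suppose that for every root of unity $\zeta$ we have the asymptotic expansion $P^{(\nu)}_{a,b,\chi}(\zeta e^{-t})\sim F(\zeta e^{-t})$ as $t\to 0^+$. Let $s$ and $N$ be positive integers and let $i\in\{0,1,\dots,s-1\}$ with $i\notin S_{a,b,\chi}(s)$. Then $$(q;q)_{\lambda(N,s)} \ \text{ divides } \ A_{F,s}(N,i,q),$$ where $\lambda(N,s)=\lfloor (N+1)/s\rfloor$.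
   Context: Notation: $(x;q)_n=(1-x)(1-xq)\cdots(1-xq^{n-1})$. For $N\ge 0$ let $F(q;N)=\sum_{n=0}^{N} f_n(q)(q;q)_n$ (a polynomial), and define polynomials $A_{F,s}(N,i,q)$, $0\le i\le s-1$, by the $s$-dissection $F(q;N)=\sum_{i=0}^{s-1} q^i A_{F,s}(N,i,q^s)$. The set $S_{a,b,\chi}(s)\subseteq\{0,1,\dots,s-1\}$ is the set of reductions modulo $s$ of the integers $\frac{n^2-a}{b}$ over all $n\in\mathbb{Z}$ with $\chi(n)\ne 0$. Meaning of $F(\zeta e^{-t})$: if $\zeta$ is a $k$th root of unity, the value $\left(\frac{d}{dt}\right)^{\ell}F(\zeta e^{-t};N)\big|_{t=0}$ is independent of $N$ for $N\ge k(\ell+1)-1$; call this common value $\left(\frac{d}{dt}\right)^{\ell}F(\zeta e^{-t})\big|_{t=0}$, and define $F(\zeta e^{-t})$ as the formal power series $\sum_{\ell\ge 0}\frac{1}{\ell!}\left(\frac{d}{dt}\right)^{\ell}F(\zeta e^{-t})\big|_{t=0}\, t^{\ell}$. The statement $P(\zeta e^{-t})\sim\sum_\ell c_\ell t^\ell$ as $t\to0^+$ means that for every $R\ge 0$, $P(\zeta e^{-t})-\sum_{\ell=0}^{R}c_\ell t^\ell=o(t^R)$ as $t\to 0^+$. *)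

theory Defs
  imports
    "HOL-Analysis.Analysis"
    "HOL-Computational_Algebra.Polynomial"
    "HOL-Computational_Algebra.Formal_Power_Series"
    "HOL-Library.Landau_Symbols"
begin

definition q_poch :: "'a::comm_ring_1 \<Rightarrow> 'a \<Rightarrow> nat \<Rightarrow> 'a" where
  "q_poch x q n = (\<Prod>k<n. 1 - x * q ^ k)"

abbreviation qq_poly :: "nat \<Rightarrow> complex poly" where
  "qq_poly n \<equiv> q_poch [:0, 1:] [:0, 1:] n"

definition root_of_unity :: "complex \<Rightarrow> bool" where
  "root_of_unity \<zeta> \<longleftrightarrow> (\<exists>k>0. \<zeta> ^ k = 1)"

definition F_trunc :: "(nat \<Rightarrow> complex poly) \<Rightarrow> nat \<Rightarrow> complex poly" where
  "F_trunc f N = (\<Sum>n\<le>N. f n * qq_poly n)"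


subsection \<open>The \<open>s\<close>-dissection of a polynomial\<close>

definition is_dissection :: "nat \<Rightarrow> complex poly \<Rightarrow> (nat \<Rightarrow> complex poly) \<Rightarrow> bool" where
  "is_dissection s p A \<longleftrightarrow> p = (\<Sum>i<s. [:0, 1:] ^ i * pcompose (A i) ([:0, 1:] ^ s))"

text \<open>The components with index below \<open>s\<close> exist and are unique, see \<open>is_dissection_part\<close> and
  \<open>dissection_part_eq\<close> below.\<close>

definition dissection_part :: "nat \<Rightarrow> complex poly \<Rightarrow> nat \<Rightarrow> complex poly" where
  "dissection_part s p i = (THE B. \<exists>A. is_dissection s p A \<and> B = A i)"

definition A_F :: "(nat \<Rightarrow> complex poly) \<Rightarrow> nat \<Rightarrow> nat \<Rightarrow> nat \<Rightarrow> complex poly" where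
  "A_F f s N i = dissection_part s (F_trunc f N) i"

lemma coeff_pcompose_X_power:
  assumes "s > 0"
  shows "coeff (pcompose p ([:0, 1:] ^ s)) n = (if s dvd n then coeff p (n div s) else (0::complex))"
proof (induction p arbitrary: n)
  case 0
  then show ?case by simp
next
  case (pCons a p)
  have "coeff (pcompose (pCons a p) ([:0, 1:] ^ s)) n
      = coeff [:a:] n + coeff (monom 1 s * pcompose p ([:0, 1:] ^ s)) n"
    by (simp add: pcompose_pCons monom_altdef)
  also have "\<dots> = (if n = 0 then a else 0)
      + (if s \<le> n then coeff (pcompose p ([:0, 1:] ^ s)) (n - s) else 0)"
    by (auto simp: coeff_monom_mult coeff_pCons split: nat.splits)
  also have "\<dots> = (if s dvd n then coeff (pCons a p) (n div s) else 0)"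
  proof (cases "n < s")
    case True
    then show ?thesis using assms by (auto simp: dest: dvd_imp_le)
  next
    case False
    have "s dvd n - s \<longleftrightarrow> s dvd n" using False by (simp add: dvd_minus_self)
    moreover have "n div s = Suc ((n - s) div s)" using False assms by (simp add: le_div_geq)
    ultimately show ?thesis using False assms pCons.IH[of "n - s"] by auto
  qed
  finally show ?case .
qed

lemma is_dissection_iff:
  assumes "s > 0"
  shows "is_dissection s p A \<longleftrightarrow> (\<forall>i<s. \<forall>j. coeff (A i) j = coeff p (s * j + i))"
proof -
  have c: "coeff (\<Sum>k<s. [:0, 1:] ^ k * pcompose (A k) ([:0, 1:] ^ s)) n = coeff (A (n mod s)) (n div s)"
    for n
  proof -
    have t: "coeff ([:0, 1:] ^ k * pcompose (A k) ([:0, 1:] ^ s)) n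
        = (if k = n mod s then coeff (A k) (n div s) else 0)" if "k < s" for k
    proof -
      have "[:0, 1:] ^ k = (monom 1 k :: complex poly)" by (simp add: monom_altdef)
      then have e: "coeff ([:0, 1:] ^ k * pcompose (A k) ([:0, 1:] ^ s)) n
          = (if k \<le> n \<and> s dvd n - k then coeff (A k) ((n - k) div s) else 0)"
        using assms by (simp add: coeff_monom_mult coeff_pcompose_X_power)
      have "k \<le> n \<and> s dvd n - k \<longleftrightarrow> k = n mod s"
        using that by (metis mod_eq_dvd_iff_nat mod_less mod_less_eq_dividend)
      moreover have "(n - n mod s) div s = n div s"
        using assms by (simp add: minus_mod_eq_mult_div)
      ultimately show ?thesis using e by auto
    qed
    show ?thesis
      unfolding coeff_sum using assms t by (simp add: sum.delta)
  qed
  show ?thesis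
  proof
    assume "is_dissection s p A"
    then have "coeff p n = coeff (A (n mod s)) (n div s)" for n
      unfolding is_dissection_def using c by metis
    then show "\<forall>i<s. \<forall>j. coeff (A i) j = coeff p (s * j + i)"
      by simp
  next
    assume *: "\<forall>i<s. \<forall>j. coeff (A i) j = coeff p (s * j + i)"
    have "coeff p n = coeff (A (n mod s)) (n div s)" for n
      using * assms by simp
    then show "is_dissection s p A"
      unfolding is_dissection_def by (intro poly_eqI) (simp only: c)
  qed
qed

lemma ex_dissection:
  assumes "s > 0"
  shows "\<exists>A. is_dissection s p A"
proof -
  define A where "A i = Abs_poly (\<lambda>j. coeff p (s * j + i))" for i
  have "coeff (A i) j = coeff p (s * j + i)" for i j
  proof -
    have "coeff p (s * m + i) = 0" if "m > degree p" for m
    proof (rule coeff_eq_0)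
      have "1 * m \<le> s * m" using assms by (intro mult_le_mono1) simp
      then show "degree p < s * m + i" using that by linarith
    qed
    then show ?thesis
      unfolding A_def by (subst coeff_Abs_poly[where n = "degree p"]) auto
  qed
  then show ?thesis using is_dissection_iff[OF assms] by blast
qed

lemma dissection_part_eq:
  assumes "is_dissection s p A" "i < s"
  shows "dissection_part s p i = A i"
  unfolding dissection_part_def
proof (rule the_equality)
  show "\<exists>A'. is_dissection s p A' \<and> A i = A' i" using assms by blast
next
  fix B assume "\<exists>A'. is_dissection s p A' \<and> B = A' i"
  then obtain A' where "is_dissection s p A'" "B = A' i" by blast
  then show "B = A i" using assms is_dissection_iff[of s p]
    by (auto intro!: poly_eqI)
qed

lemma is_dissection_part:
  assumes "s > 0"
  shows "is_dissection s p (dissection_part s p)"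
proof -
  obtain A where A: "is_dissection s p A" using ex_dissection[OF assms] by blast
  then show ?thesis
    using is_dissection_iff[OF assms] dissection_part_eq[OF A] by simp
qed


subsection \<open>Expansion of \<open>F\<close> at a root of unity\<close>

definition F_trunc_deriv :: "(nat \<Rightarrow> complex poly) \<Rightarrow> complex \<Rightarrow> nat \<Rightarrow> nat \<Rightarrow> complex" where
  "F_trunc_deriv f \<zeta> N l = (deriv ^^ l) (\<lambda>t. poly (F_trunc f N) (\<zeta> * exp (- t))) 0"

text \<open>The common value of the truncated derivatives; it exists by \<open>F_deriv_eq\<close> below.\<close>

definition F_deriv :: "(nat \<Rightarrow> complex poly) \<Rightarrow> complex \<Rightarrow> nat \<Rightarrow> complex" where
  "F_deriv f \<zeta> l =
     (THE c. \<forall>k N. k > 0 \<and> \<zeta> ^ k = 1 \<and> N \<ge> k * (l + 1) - 1 \<longrightarrow> F_trunc_deriv f \<zeta> N l = c)"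

definition F_series :: "(nat \<Rightarrow> complex poly) \<Rightarrow> complex \<Rightarrow> complex fps" where
  "F_series f \<zeta> = Abs_fps (\<lambda>l. F_deriv f \<zeta> l / fact l)"

lemma higher_deriv_poly_exp:
  fixes p :: "complex poly"
  shows "(deriv ^^ l) (\<lambda>t. poly p (\<zeta> * exp (- t)))
       = (\<lambda>t. poly (((\<lambda>r. - ([:0, 1:] * pderiv r)) ^^ l) p) (\<zeta> * exp (- t)))"
proof (induction l)
  case 0
  then show ?case by simp
next
  case (Suc l)
  define r where "r = ((\<lambda>r. - ([:0, 1:] * pderiv r)) ^^ l) p"
  have "deriv (\<lambda>t. poly r (\<zeta> * exp (- t))) t = poly (- ([:0, 1:] * pderiv r)) (\<zeta> * exp (- t))" for t
    by (rule DERIV_imp_deriv)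
      (auto intro!: derivative_eq_intros DERIV_chain2[OF poly_DERIV])
  then show ?case unfolding funpow.simps comp_def Suc r_def[symmetric] by (rule ext)
qed

lemma higher_deriv_poly_exp_eq_0:
  fixes p :: "complex poly"
  assumes "[:- \<zeta>, 1:] ^ Suc l dvd p"
  shows "(deriv ^^ l) (\<lambda>t. poly p (\<zeta> * exp (- t))) 0 = 0"
proof -
  define D where "D = (\<lambda>r::complex poly. - ([:0, 1:] * pderiv r))"
  have step: "[:- \<zeta>, 1:] ^ m dvd D r" if r: "[:- \<zeta>, 1:] ^ Suc m dvd r" for m r
  proof -
    obtain u where "r = [:- \<zeta>, 1:] ^ Suc m * u" using r by (elim dvdE)
    then have "pderiv r = [:- \<zeta>, 1:] ^ m * ([:- \<zeta>, 1:] * pderiv u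
        + u * smult (of_nat (Suc m)) (pderiv [:- \<zeta>, 1:]))"
      by (simp only: pderiv_mult pderiv_power_Suc) (simp add: algebra_simps)
    then have "[:- \<zeta>, 1:] ^ m dvd pderiv r" by (metis dvd_triv_left)
    then show ?thesis unfolding D_def by (metis dvd_minus_iff dvd_mult)
  qed
  have "[:- \<zeta>, 1:] ^ Suc l dvd q \<Longrightarrow> [:- \<zeta>, 1:] dvd (D ^^ l) q" for q
  proof (induction l arbitrary: q)
    case (Suc l)
    then show ?case using step[of "Suc l" q] by (simp add: funpow_swap1)
  qed simp
  then have "poly ((D ^^ l) p) \<zeta> = 0" using assms by (simp add: poly_eq_0_iff_dvd)
  then show ?thesis by (simp add: higher_deriv_poly_exp D_def)
qed

lemma power_dvd_qq_poly:
  assumes "k > 0" "\<zeta> ^ k = 1" "n \<ge> k * m"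
  shows "[:- \<zeta>, 1:] ^ m dvd qq_poly n"
  using assms(3)
proof (induction m arbitrary: n)
  case (Suc m)
  define j where "j = k * Suc m - 1"
  have j: "Suc j = k * Suc m" "k * m \<le> j" using assms(1) by (auto simp: j_def)
  have "[:- \<zeta>, 1:] dvd 1 - [:0, 1:] * [:0, 1:] ^ j"
  proof -
    have "\<zeta> ^ Suc j = 1" unfolding j(1) power_mult assms(2) by simp
    then show ?thesis by (simp add: poly_eq_0_iff_dvd[symmetric])
  qed
  then have "[:- \<zeta>, 1:] * [:- \<zeta>, 1:] ^ m dvd (1 - [:0, 1:] * [:0, 1:] ^ j) * qq_poly j"
    using Suc.IH[OF j(2)] by (rule mult_dvd_mono)
  also have "\<dots> = qq_poly (Suc j)"
    unfolding q_poch_def prod.lessThan_Suc by (rule mult.commute)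
  finally have "[:- \<zeta>, 1:] ^ Suc m dvd qq_poly (Suc j)"
    unfolding power_Suc .
  also have "qq_poly (Suc j) dvd qq_poly n"
    unfolding q_poch_def using Suc.prems j(1) by (intro prod_dvd_prod_subset) auto
  finally show ?case .
qed simp

lemma F_trunc_deriv_indep:
  assumes "k > 0" "\<zeta> ^ k = 1" "N \<ge> k * (l + 1) - 1" "M \<ge> N"
  shows "F_trunc_deriv f \<zeta> M l = F_trunc_deriv f \<zeta> N l"
proof -
  define D where "D = (\<lambda>r::complex poly. - ([:0, 1:] * pderiv r))"
  have D_add: "(D ^^ l) (p + q) = (D ^^ l) p + (D ^^ l) q" for p q
    by (induction l) (auto simp: D_def pderiv_add algebra_simps)
  define R where "R = (\<Sum>n\<in>{N<..M}. f n * qq_poly n)"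
  have "F_trunc f M = F_trunc f N + R"
  proof -
    have "{..M} = {..N} \<union> {N<..M}" using assms(4) by auto
    then have "F_trunc f M = (\<Sum>n\<in>{..N} \<union> {N<..M}. f n * qq_poly n)" by (simp add: F_trunc_def)
    also have "\<dots> = F_trunc f N + R"
      unfolding F_trunc_def R_def by (rule sum.union_disjoint) auto
    finally show ?thesis .
  qed
  then have "F_trunc_deriv f \<zeta> M l = F_trunc_deriv f \<zeta> N l
      + (deriv ^^ l) (\<lambda>t. poly R (\<zeta> * exp (- t))) 0"
    unfolding F_trunc_deriv_def higher_deriv_poly_exp D_def[symmetric] by (simp add: D_add)
  moreover have "[:- \<zeta>, 1:] ^ Suc l dvd R"
    unfolding R_def
  proof (intro dvd_sum dvd_mult power_dvd_qq_poly[OF assms(1,2)])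
    fix n assume "n \<in> {N<..M}"
    then show "k * Suc l \<le> n" using assms(3) by auto
  qed
  ultimately show ?thesis by (simp only: higher_deriv_poly_exp_eq_0) simp
qed

lemma F_deriv_eq:
  assumes "k > 0" "\<zeta> ^ k = 1" "N \<ge> k * (l + 1) - 1"
  shows "F_deriv f \<zeta> l = F_trunc_deriv f \<zeta> N l"
  unfolding F_deriv_def
proof (rule the_equality)
  show "\<forall>k' N'. k' > 0 \<and> \<zeta> ^ k' = 1 \<and> N' \<ge> k' * (l + 1) - 1
      \<longrightarrow> F_trunc_deriv f \<zeta> N' l = F_trunc_deriv f \<zeta> N l"
    by (metis F_trunc_deriv_indep assms max.cobounded1 max.cobounded2)
qed (use assms in blast)


subsection \<open>Partial theta functions\<close>

text \<open>All uses of \<open>(n\<^sup>2 - a) div b\<close> are multiplied by \<open>chi n\<close> or guarded by \<open>chi n \<noteq> 0\<close>, where the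
  division is exact; the exponent may be negative.\<close>

definition theta_exp :: "int \<Rightarrow> int \<Rightarrow> int \<Rightarrow> int" where
  "theta_exp a b n = (n\<^sup>2 - a) div b"

definition periodic_mean_zero :: "(int \<Rightarrow> complex) \<Rightarrow> bool" where
  "periodic_mean_zero g \<longleftrightarrow>
     (\<exists>M>0. (\<forall>n. g (n + M) = g n) \<and> (\<Sum>n\<in>{0..<M}. g n) / of_int M = 0)"

definition S_set :: "int \<Rightarrow> int \<Rightarrow> (int \<Rightarrow> complex) \<Rightarrow> nat \<Rightarrow> nat set" where
  "S_set a b chi s = {nat (theta_exp a b n mod int s) | n. chi n \<noteq> 0}"

definition partial_theta ::
    "nat \<Rightarrow> int \<Rightarrow> int \<Rightarrow> (int \<Rightarrow> complex) \<Rightarrow> complex \<Rightarrow> complex" where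
  "partial_theta \<nu> a b chi q =
     (\<Sum>n. of_nat n ^ \<nu> * chi (int n) * q powi theta_exp a b (int n))"

definition has_expansion_at_0 :: "(real \<Rightarrow> complex) \<Rightarrow> complex fps \<Rightarrow> bool" where
  "has_expansion_at_0 P c \<longleftrightarrow>
     (\<forall>R. (\<lambda>t. P t - (\<Sum>l\<le>R. fps_nth c l * of_real t ^ l)) \<in> o[at_right 0](\<lambda>t. of_real t ^ R))"

end

theory Submission
  imports Defs "HOL-Computational_Algebra.Fundamental_Theorem_Algebra"
begin

text \<open>
  Write \<open>\<omega>\<close> for a primitive \<open>s\<close>-th root of unity. No exponent of the partial theta function is
  congruent to \<open>i\<close> modulo \<open>s\<close>, so the filter \<open>\<Sum>\<^sub>k \<omega>\<^bsup>- ik\<^esup> P(\<omega>\<^sup>k q)\<close> vanishes identically, and by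
  uniqueness of asymptotic expansions so does \<open>\<Sum>\<^sub>k \<omega>\<^bsup>- ik\<^esup> F(\<omega>\<^sup>k \<zeta> e\<^bsup>- t\<^esup>)\<close> for every root of unity
  \<open>\<zeta>\<close>. If \<open>\<eta> = \<zeta>\<^sup>s\<close> has order \<open>m\<close>, then all \<open>\<omega>\<^sup>k \<zeta>\<close> are \<open>sm\<close>-th roots of unity, so for
  \<open>l < \<lambda>(N, s) div m\<close> the \<open>l\<close>-th coefficients are those of the truncation \<open>F(q; N)\<close>, whose filter is
  \<open>s q\<^sup>i A\<^sub>i(q\<^sup>s)\<close>. Hence \<open>A\<^sub>i\<close> vanishes at \<open>\<eta>\<close> to order at least \<open>\<lambda>(N, s) div m\<close>, which is the order of
  \<open>(q; q)\<close> with index \<open>\<lambda>(N, s)\<close> at \<open>\<eta>\<close>.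
\<close>

section \<open>Orders of vanishing and divisibility\<close>

text \<open>Induction on the degree: a root of a nonconstant \<open>p\<close> is also a root of
  \<open>q\<close>, and cancelling the common linear factor lowers both orders equally. This turns
  the final divisibility into a comparison of orders point by point.\<close>

lemma poly_dvd_if_order_le:
  fixes p q :: "'a::alg_closed_field poly"
  assumes "p \<noteq> 0" "q \<noteq> 0" "\<And>x. order x p \<le> order x q"
  shows "p dvd q"
  using assms
proof (induction "degree p" arbitrary: p q)
  case 0
  then have "is_unit p" by (simp add: is_unit_iff_degree)
  then show ?case by (rule unit_imp_dvd)
next
  case (Suc d)
  then obtain x where x: "poly p x = 0" using alg_closed_imp_poly_has_root[of p] by auto
  then obtain p' where p': "p = [:- x, 1:] * p'" by (auto simp: poly_eq_0_iff_dvd)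
  have "poly q x = 0" using x Suc.prems by (metis le_zero_eq order_root)
  then obtain q' where q': "q = [:- x, 1:] * q'" by (auto simp: poly_eq_0_iff_dvd)
  have nz: "p' \<noteq> 0" "q' \<noteq> 0" using Suc.prems p' q' by auto
  have "degree p = Suc (degree p')" using nz by (simp add: p' degree_mult_eq del: mult_pCons_left)
  then have "d = degree p'" using Suc.hyps by simp
  moreover have "order y p' \<le> order y q'" for y
    using Suc.prems(3)[of y] nz order_mult[of "[:- x, 1:]" p' y] order_mult[of "[:- x, 1:]" q' y]
    unfolding p' q' by (simp del: mult_pCons_left)
  ultimately have "p' dvd q'" using Suc.hyps(1) nz by blast
  then show ?case unfolding p' q' by (rule mult_dvd_mono[OF dvd_refl])
qed

text \<open>The derivative \<open>n X^(n-1)\<close> has no nonzero root, so every nonzero root is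
  simple.\<close>

lemma order_monom_minus_const_le:
  fixes z c :: "'a::field_char_0"
  assumes "z \<noteq> 0" "n > 0"
  shows "order z (monom 1 n - [:c:]) \<le> 1"
proof (cases "order z (monom 1 n - [:c:]) = 0")
  case False
  have d: "pderiv (monom 1 n - [:c:]) = monom (of_nat n) (n - 1)"
    by (simp add: pderiv_diff pderiv_monom pderiv_pCons)
  have "monom 1 n - [:c:] \<noteq> 0" using d assms(2) by auto
  then have "order z (monom 1 n - [:c:]) = Suc (order z (monom (of_nat n) (n - 1)))"
    using order_pderiv[of "monom 1 n - [:c:]" z] d False order_root by metis
  moreover have "order z (monom (of_nat n) (n - 1)) = 0"
    using assms by (intro order_0I) (simp add: poly_monom)
  ultimately show ?thesis by simp
qed simp

lemma monom_minus_const_neq_0: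
  fixes c :: "'a::field_char_0"
  assumes "n > 0"
  shows "monom 1 n - [:c:] \<noteq> 0"
proof
  assume "monom 1 n - [:c:] = 0"
  then have "coeff (monom 1 n - [:c:]) n = 0" by simp
  then show False using assms by (simp add: coeff_pCons split: nat.splits)
qed

lemma order_power:
  fixes p :: "'a::idom poly"
  assumes "p \<noteq> 0"
  shows "order x (p ^ k) = k * order x p"
  by (induction k) (use assms in \<open>simp_all add: order_mult\<close>)

lemma pcompose_power: "pcompose (p ^ k) q = pcompose p q ^ k"
  for p q :: "'a::comm_semiring_1 poly"
  by (induction k) (simp_all add: pcompose_mult pcompose_1)

lemma qq_poly_Suc: "qq_poly (Suc n) = qq_poly n * - (monom 1 (Suc n) - [:1:])"
  by (simp add: q_poch_def monom_altdef one_pCons)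

lemma qq_poly_neq_0: "qq_poly n \<noteq> 0"
proof (induction n)
  case (Suc n)
  then show ?case using monom_minus_const_neq_0[of "Suc n" "1::complex"]
    unfolding qq_poly_Suc by simp
qed (simp add: q_poch_def)

text \<open>A factor \<open>1 - X^j\<close> vanishes at \<eta> only if \<open>m\<close> divides
  \<open>j\<close>, and then simply; \<open>n div m\<close> counts these \<open>j\<close> from 1 to
  \<open>n\<close>.\<close>

lemma order_qq_poly_le:
  assumes "m > 0" "\<eta> \<noteq> 0" "\<And>n. \<eta> ^ n = 1 \<Longrightarrow> m dvd n"
  shows "order \<eta> (qq_poly n) \<le> n div m"
proof (induction n)
  case 0
  show ?case by (simp add: q_poch_def)
next
  case (Suc n)
  let ?g = "monom 1 (Suc n) - [:1:] :: complex poly"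
  have "order \<eta> (qq_poly (Suc n)) = order \<eta> (qq_poly n) + order \<eta> ?g"
    using qq_poly_neq_0[of "Suc n"] unfolding qq_poly_Suc
    by (subst order_mult) (auto simp: order_uminus simp del: minus_diff_eq)
  moreover have "order \<eta> ?g \<le> (if m dvd Suc n then 1 else 0)"
  proof (cases "m dvd Suc n")
    case True
    then show ?thesis using order_monom_minus_const_le[OF assms(2), of "Suc n" 1] by simp
  next
    case False
    then have "poly ?g \<eta> \<noteq> 0" using assms(3)[of "Suc n"] by (auto simp: poly_monom)
    then show ?thesis by (simp add: order_0I)
  qed
  moreover have "Suc n div m = n div m + (if m dvd Suc n then 1 else 0)"
    using assms(1) by (simp add: div_Suc dvd_eq_mod_eq_0)
  ultimately show ?case using Suc.IH by linarith
qed

text \<open>Since \<open>\<zeta> \<noteq> 0\<close> is a simple zero of \<open>X\<^sup>s - \<zeta>\<^sup>s\<close>, substituting \<open>X\<^sup>s\<close> preserves the order.\<close>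

lemma linear_power_dvd_of_pcompose:
  fixes A :: "'a::field_char_0 poly"
  assumes "\<zeta> \<noteq> 0" "s > 0" "[:- \<zeta>, 1:] ^ M dvd monom 1 i * pcompose A (monom 1 s)"
  shows "[:- (\<zeta> ^ s), 1:] ^ M dvd A"
proof (cases "A = 0")
  case False
  define k where "k = order (\<zeta> ^ s) A"
  obtain B where B: "A = [:- (\<zeta> ^ s), 1:] ^ k * B" "\<not> [:- (\<zeta> ^ s), 1:] dvd B"
    using order_decomp[OF False] unfolding k_def by blast
  let ?g = "monom 1 s - [:\<zeta> ^ s:]" and ?C = "pcompose B (monom 1 s)"
  have "pcompose [:- (\<zeta> ^ s), 1:] (monom 1 s) = ?g"
    by (simp add: pcompose_pCons)
  then have e: "monom 1 i * pcompose A (monom 1 s) = monom 1 i * (?g ^ k * ?C)"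
    by (simp add: B pcompose_mult pcompose_power)
  \<comment> \<open>Neither \<open>X^i\<close> nor the composed cofactor vanishes at \<zeta>, so the
    order there comes from \<open>?g ^ k\<close> alone.\<close>
  have C: "poly (monom 1 i) \<zeta> \<noteq> 0" "poly ?C \<zeta> \<noteq> 0"
    using B(2) assms(1) by (simp_all add: poly_pcompose poly_monom poly_eq_0_iff_dvd)
  then have nz: "monom 1 i * (?g ^ k * ?C) \<noteq> 0"
    using monom_minus_const_neq_0[OF assms(2)] by auto
  then have "order \<zeta> (monom 1 i * (?g ^ k * ?C)) = k * order \<zeta> ?g"
    using C order_power[OF monom_minus_const_neq_0[OF assms(2)], of \<zeta> "\<zeta> ^ s" k]
    by (simp add: order_mult order_0I)
  also have "\<dots> \<le> k"
    using order_monom_minus_const_le[OF assms(1,2), of "\<zeta> ^ s"]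
      mult_le_mono2[of _ 1 k] by simp
  finally have "order \<zeta> (monom 1 i * (?g ^ k * ?C)) \<le> k" .
  moreover have "M \<le> order \<zeta> (monom 1 i * (?g ^ k * ?C))"
    using assms(3) nz unfolding e order_divides by blast
  ultimately have "M \<le> k" by linarith
  then show ?thesis unfolding k_def by (simp add: order_divides)
qed simp


section \<open>The negated Euler operator\<close>

text \<open>Under the substitution \<open>X = \<zeta> exp (- t)\<close> this is the derivative with respect to \<open>t\<close>.\<close>

definition neg_euler :: "complex poly \<Rightarrow> complex poly" where
  "neg_euler r = - ([:0, 1:] * pderiv r)"

text \<open>Monomials are eigenvectors, so the operator respects the splitting of a polynomial by
  residue classes of exponents.\<close>

lemma coeff_neg_euler_power:
  "coeff ((neg_euler ^^ l) p) n = (- of_nat n) ^ l * coeff p n"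
proof (induction l)
  case (Suc l)
  have "coeff (neg_euler r) n = - of_nat n * coeff r n" for r
    by (cases n) (simp_all add: neg_euler_def coeff_pderiv algebra_simps)
  then show ?case using Suc.IH by simp
qed simp

text \<open>A converse to \<open>higher_deriv_poly_exp_eq_0\<close>. As \<zeta> is nonzero, the
  factor \<open>X\<close> does not change the order at \<zeta>, and a zero of \<open>p\<close> has
  order one more than in \<open>pderiv p\<close>.\<close>

lemma linear_power_dvd_if_neg_euler:
  assumes "\<zeta> \<noteq> 0" "\<And>l. l < M \<Longrightarrow> poly ((neg_euler ^^ l) p) \<zeta> = 0"
  shows "[:- \<zeta>, 1:] ^ M dvd p"
  using assms(2)
proof (induction M arbitrary: p)
  case (Suc M)
  have p0: "poly p \<zeta> = 0" using Suc.prems[of 0] by simp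
  show ?case
  proof (cases "pderiv p = 0")
    case True
    then obtain c where "p = [:c:]" using pderiv_iszero by blast
    then show ?thesis using p0 by simp
  next
    case False
    \<comment> \<open>Replacing \<open>p\<close> by \<open>neg_euler p\<close> shifts the vanishing
      conditions by one.\<close>
    have "[:- \<zeta>, 1:] ^ M dvd neg_euler p"
      using Suc.prems[of "Suc _"] by (intro Suc.IH) (simp add: funpow_swap1)
    then have "M \<le> order \<zeta> ([:0, 1:] * pderiv p)"
      using False by (simp add: neg_euler_def order_divides del: mult_pCons_left)
    also have "\<dots> = order \<zeta> (pderiv p)"
      using False assms(1) by (subst order_mult) (auto intro: order_0I simp del: mult_pCons_left)
    finally have "M \<le> order \<zeta> (pderiv p)" .
    moreover have "p \<noteq> 0" using False by auto
    ultimately show ?thesis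
      using p0 order_pderiv[of p \<zeta>] by (simp add: order_divides del: power_Suc)
  qed
qed simp

lemma F_trunc_deriv_eq: "F_trunc_deriv f \<zeta> N l = poly ((neg_euler ^^ l) (F_trunc f N)) \<zeta>"
  unfolding F_trunc_deriv_def higher_deriv_poly_exp neg_euler_def[abs_def] by simp


section \<open>The roots of unity filter\<close>

text \<open>A geometric sum whose ratio is an \<open>s\<close>-th root of unity, equal to 1 exactly
  when \<open>s\<close> divides \<open>e\<close>.\<close>

lemma sum_root_of_unity_powers:
  assumes "s > 0"
  defines "\<omega> \<equiv> cis (2 * pi / of_nat s)"
  shows "(\<Sum>k<s. (\<omega> powi e) ^ k) = (if int s dvd e then of_nat s else 0)"
proof -
  have ws: "\<omega> powi (int s * j) = 1" for j
    using assms(1) cis_multiple_2pi[of "of_int j"] by (simp add: \<omega>_def cis_power_int mult_ac)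
  show ?thesis
  proof (cases "int s dvd e")
    case True
    then show ?thesis using ws by (auto elim!: dvdE)
  next
    case False
    have "\<omega> powi e \<noteq> 1"
    proof
      assume "\<omega> powi e = 1"
      then have "cis (of_int e * (2 * pi / of_nat s)) = 1"
        unfolding \<omega>_def cis_power_int .
      then have "cos (of_int e * (2 * pi / of_nat s)) = 1"
        by (simp add: complex_eq_iff)
      then obtain j :: int where "of_int e * (2 * pi / of_nat s) = of_int j * 2 * pi"
        using cos_one_2pi_int by blast
      then have "real_of_int e = real_of_int (j * int s)" using assms(1) by (simp add: field_simps)
      then show False using False by (simp only: of_int_eq_iff) simp
    qed
    moreover have "(\<omega> powi e) ^ s = 1"
      using ws[of e] by (metis mult.commute power_int_mult power_int_of_nat)
    ultimately show ?thesis using False geometric_sum[of "\<omega> powi e" s] by simp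
  qed
qed

text \<open>Integer exponents let one filter serve both polynomials and theta series, whose
  exponents may be negative.\<close>

lemma power_root_of_unity_filter:
  assumes "s > 0" "x \<noteq> 0"
  defines "\<omega> \<equiv> cis (2 * pi / of_nat s)"
  shows "(\<Sum>k<s. (\<omega> powi (- j)) ^ k * (\<omega> ^ k * x) powi e)
       = (if int s dvd e - j then of_nat s * x powi e else 0)"
proof -
  have w: "\<omega> \<noteq> 0" by (simp add: \<omega>_def)
  have "(\<omega> powi (- j)) ^ k * (\<omega> ^ k * x) powi e = (\<omega> powi (e - j)) ^ k * x powi e" for k
  proof -
    have "(\<omega> ^ k) powi e = (\<omega> powi e) ^ k"
      by (metis mult.commute power_int_mult power_int_of_nat)
    moreover have "\<omega> powi (e - j) = \<omega> powi (- j) * \<omega> powi e"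
      using w power_int_add[of \<omega> "- j" e] by simp
    ultimately show ?thesis by (simp add: power_int_mult_distrib power_mult_distrib)
  qed
  then have "(\<Sum>k<s. (\<omega> powi (- j)) ^ k * (\<omega> ^ k * x) powi e)
      = (\<Sum>k<s. (\<omega> powi (e - j)) ^ k) * x powi e"
    by (simp add: sum_distrib_right)
  then show ?thesis using sum_root_of_unity_powers[OF assms(1), of "e - j"] by (simp add: \<omega>_def)
qed

lemma coeff_dissection_part:
  assumes "i < s"
  shows "coeff (monom 1 i * pcompose (dissection_part s p i) (monom 1 s)) n
       = (if n mod s = i then coeff p n else 0)"
proof -
  have s: "s > 0" using assms by simp
  have c: "coeff (dissection_part s p i) j = coeff p (s * j + i)" for j
    using is_dissection_part[OF s] assms by (simp add: is_dissection_iff[OF s])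
  have "coeff (monom 1 i * pcompose (dissection_part s p i) (monom 1 s)) n
      = (if i \<le> n \<and> s dvd n - i then coeff p (s * ((n - i) div s) + i) else 0)"
    using coeff_pcompose_X_power[OF s] by (simp add: coeff_monom_mult c monom_altdef[of 1 s])
  moreover have "i \<le> n \<and> s dvd n - i \<longleftrightarrow> n mod s = i"
    using assms by (metis mod_eq_dvd_iff_nat mod_less mod_less_eq_dividend)
  ultimately show ?thesis by auto
qed

text \<open>Since \<open>neg_euler\<close> is diagonal on monomials, filtering after
  \<open>l\<close> applications still selects the exponents congruent to \<open>i\<close>.\<close>

lemma dissection_part_filter:
  fixes p :: "complex poly"
  assumes "i < s" "x \<noteq> 0"
  defines "\<omega> \<equiv> cis (2 * pi / of_nat s)"
  defines "B \<equiv> monom 1 i * pcompose (dissection_part s p i) (monom 1 s)"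
  shows "(\<Sum>k<s. (\<omega> powi (- int i)) ^ k * poly ((neg_euler ^^ l) p) (\<omega> ^ k * x))
       = of_nat s * poly ((neg_euler ^^ l) B) x"
proof -
  let ?p = "(neg_euler ^^ l) p" and ?B = "(neg_euler ^^ l) B"
  \<comment> \<open>A common degree bound writes both polynomials as sums over the same
    range.\<close>
  define d where "d = max (degree ?p) (degree ?B)"
  have P: "poly r y = (\<Sum>n\<le>d. coeff r n * y ^ n)" if "degree r \<le> d" for r :: "complex poly" and y
    unfolding poly_altdef by (rule sum.mono_neutral_left) (use that in \<open>auto intro: coeff_eq_0\<close>)
  have cB: "coeff ?B n = (if n mod s = i then coeff ?p n else 0)" for n
    unfolding coeff_neg_euler_power B_def coeff_dissection_part[OF assms(1)] by simp
  have m: "int s dvd int n - int i \<longleftrightarrow> n mod s = i" for n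
    using assms(1) by (metis mod_eq_dvd_iff mod_less of_nat_eq_iff zmod_int)
  have "(\<Sum>k<s. (\<omega> powi (- int i)) ^ k * poly ?p (\<omega> ^ k * x))
      = (\<Sum>k<s. \<Sum>n\<le>d. coeff ?p n * ((\<omega> powi (- int i)) ^ k * (\<omega> ^ k * x) powi int n))"
    by (subst P) (simp_all add: d_def sum_distrib_left mult_ac)
  also have "\<dots> = (\<Sum>n\<le>d. coeff ?p n * (\<Sum>k<s. (\<omega> powi (- int i)) ^ k * (\<omega> ^ k * x) powi int n))"
    unfolding sum_distrib_left by (rule sum.swap)
  also have "\<dots> = (\<Sum>n\<le>d. coeff ?p n * (if n mod s = i then of_nat s * x powi int n else 0))"
    using assms(1,2) unfolding \<omega>_def by (subst power_root_of_unity_filter) (simp_all add: m cong: if_cong)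
  also have "\<dots> = of_nat s * (\<Sum>n\<le>d. coeff ?B n * x ^ n)"
    unfolding sum_distrib_left by (rule sum.cong) (auto simp: cB power_int_of_nat)
  also have "\<dots> = of_nat s * poly ?B x"
    by (subst P) (simp_all add: d_def)
  finally show ?thesis .
qed


section \<open>Asymptotic expansions\<close>

lemma has_expansion_at_0_sum:
  assumes "finite K" "\<And>k. k \<in> K \<Longrightarrow> has_expansion_at_0 (P k) (c k)"
  shows "has_expansion_at_0 (\<lambda>t. \<Sum>k\<in>K. a k * P k t) (\<Sum>k\<in>K. fps_const (a k) * c k)"
  unfolding has_expansion_at_0_def
proof
  fix R
  have "(\<lambda>t. \<Sum>k\<in>K. a k * (P k t - (\<Sum>l\<le>R. fps_nth (c k) l * of_real t ^ l)))
      \<in> o[at_right 0](\<lambda>t. of_real t ^ R)"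
  proof (intro big_sum_in_smallo)
    fix k assume "k \<in> K"
    \<comment> \<open>A zero weight is split off because only a nonzero constant factor can be
      cancelled inside \<open>o\<close>.\<close>
    then show "(\<lambda>t. a k * (P k t - (\<Sum>l\<le>R. fps_nth (c k) l * of_real t ^ l)))
        \<in> o[at_right 0](\<lambda>t. of_real t ^ R)"
      using assms(2) unfolding has_expansion_at_0_def by (cases "a k = 0") auto
  qed
  moreover have "(\<Sum>k\<in>K. a k * (P k t - (\<Sum>l\<le>R. fps_nth (c k) l * of_real t ^ l)))
      = (\<Sum>k\<in>K. a k * P k t) - (\<Sum>l\<le>R. fps_nth (\<Sum>k\<in>K. fps_const (a k) * c k) l * of_real t ^ l)"
    for t
  proof -
    have "(\<Sum>l\<le>R. fps_nth (\<Sum>k\<in>K. fps_const (a k) * c k) l * of_real t ^ l)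
        = (\<Sum>k\<in>K. a k * (\<Sum>l\<le>R. fps_nth (c k) l * of_real t ^ l))"
      unfolding sum_distrib_left by (subst sum.swap) (simp add: fps_sum_nth sum_distrib_right mult.assoc)
    then show ?thesis by (simp add: right_diff_distrib sum_subtractf)
  qed
  ultimately show "(\<lambda>t. (\<Sum>k\<in>K. a k * P k t)
        - (\<Sum>l\<le>R. fps_nth (\<Sum>k\<in>K. fps_const (a k) * c k) l * of_real t ^ l))
      \<in> o[at_right 0](\<lambda>t. of_real t ^ R)"
    by simp
qed

text \<open>Strong induction: once the lower coefficients vanish, the expansion to order
  \<open>R\<close> says that \<open>c_R t^R\<close> is \<open>o(t^R)\<close>.\<close>

lemma has_expansion_at_0_unique:
  assumes "has_expansion_at_0 P c" "\<And>t. t > 0 \<Longrightarrow> P t = 0"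
  shows "c = 0"
proof (rule fps_ext)
  fix R
  show "fps_nth c R = fps_nth 0 R"
  proof (induction R rule: less_induct)
    case (less R)
    have "(\<Sum>l\<le>R. fps_nth c l * of_real t ^ l) = fps_nth c R * of_real t ^ R" for t :: real
      using less by (subst sum.mono_neutral_right[of "{..R}" "{R}"]) auto
    then have "(\<lambda>t. P t - fps_nth c R * of_real t ^ R) \<in> o[at_right 0](\<lambda>t. of_real t ^ R)"
      using assms(1)[unfolded has_expansion_at_0_def, rule_format, of R] by simp
    moreover have ev: "\<forall>\<^sub>F t in at_right 0. (t::real) > 0"
      by (simp add: eventually_at_right_less)
    ultimately have "(\<lambda>t. - fps_nth c R * of_real t ^ R) \<in> o[at_right 0](\<lambda>t. of_real t ^ R)"
      by (subst (asm) landau_o.small.in_cong[where g = "\<lambda>t. - fps_nth c R * of_real t ^ R"])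
        (auto elim!: eventually_mono simp: assms(2))
    then have "fps_nth c R = 0 \<or> (\<lambda>t. of_real t ^ R :: complex) \<in> o[at_right 0](\<lambda>t. of_real t ^ R)"
      by (cases "fps_nth c R = 0") auto
    \<comment> \<open>A function is little-o of itself only if it is eventually zero, which
      \<open>t^R\<close> is not to the right of 0.\<close>
    moreover have "\<not> (\<forall>\<^sub>F t in at_right (0::real). of_real t ^ R = (0::complex))"
    proof
      assume "\<forall>\<^sub>F t in at_right (0::real). of_real t ^ R = (0::complex)"
      with ev have "\<forall>\<^sub>F t in at_right (0::real). False" by eventually_elim auto
      then show False by simp
    qed
    ultimately show ?case by (auto simp: landau_o.small_refl_iff)
  qed
qed


section \<open>The partial theta function\<close>

text \<open>A linear lower bound, obtained from \<open>(2n - b)^2 \<ge> 0\<close>, is enough to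
  compare the theta series with a power series.\<close>

lemma theta_exp_ge:
  assumes "a \<ge> 0" "b > 0"
  shows "theta_exp a b n \<ge> n - (a + b)"
proof -
  have "0 \<le> (2 * n - b)\<^sup>2" by simp
  then have "4 * (n * b) \<le> 4 * n\<^sup>2 + b\<^sup>2" by (simp add: power2_eq_square algebra_simps)
  moreover have "a \<le> a * b" using assms by (simp add: mult_le_cancel_left1)
  moreover have "0 \<le> b\<^sup>2" "0 \<le> n\<^sup>2" by simp_all
  ultimately have "(n - (a + b)) * b \<le> n\<^sup>2 - a"
    unfolding left_diff_distrib distrib_right power2_eq_square[of b] by linarith
  then have "(n - (a + b)) * b div b \<le> (n\<^sup>2 - a) div b"
    by (rule zdiv_mono1) (rule assms(2))
  then show ?thesis using assms(2) by (simp add: theta_exp_def)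
qed

text \<open>Comparison with a multiple of the series of \<open>(n + 1) |q|^n\<close>, where
  \<open>n + 1\<close> covers both values of \<nu>.\<close>

lemma summable_partial_theta:
  fixes q :: complex
  assumes "\<nu> \<in> {0, 1}" "a \<ge> 0" "b > 0" "\<And>n. norm (chi n) \<le> B" "0 < norm q" "norm q < 1"
  shows "summable (\<lambda>n. of_nat n ^ \<nu> * chi (int n) * q powi theta_exp a b (int n))"
proof -
  let ?C = "B * norm q powi (- (a + b))"
  have le: "norm (of_nat n ^ \<nu> * chi (int n) * q powi theta_exp a b (int n))
      \<le> ?C * (of_nat (Suc n) * norm q ^ n)" for n
  proof -
    have "norm q powi theta_exp a b (int n) \<le> norm q powi (int n - (a + b))"
      using assms theta_exp_ge[of a b "int n"] by (intro power_int_decreasing) auto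
    also have "\<dots> = norm q powi (- (a + b)) * norm q ^ n"
      using assms(5) power_int_add[of "norm q" "- (a + b)" "int n"] by (simp add: algebra_simps)
    finally have "norm q powi theta_exp a b (int n) \<le> norm q powi (- (a + b)) * norm q ^ n" .
    moreover have "real n ^ \<nu> \<le> real (Suc n)" using assms(1) by auto
    then have "real n ^ \<nu> * norm (chi (int n)) \<le> real (Suc n) * B"
      by (rule mult_mono) (simp_all add: assms(4))
    moreover have "0 \<le> B" using assms(4) norm_ge_zero order_trans by blast
    ultimately have "(real n ^ \<nu> * norm (chi (int n))) * norm q powi theta_exp a b (int n)
        \<le> (real (Suc n) * B) * (norm q powi (- (a + b)) * norm q ^ n)"
      by (intro mult_mono[of "real n ^ \<nu> * norm (chi (int n))"]) simp_all
    then show ?thesis by (simp add: norm_mult norm_power norm_power_int mult_ac)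
  qed
  have "summable (\<lambda>n. ?C * (of_nat (Suc n) * norm q ^ n))"
    using geometric_deriv_sums[of "norm q"] assms(6) by (intro summable_mult) (auto simp: sums_iff)
  then show ?thesis by (rule summable_comparison_test') (rule le)
qed

text \<open>Summability allows the finite filter to be applied termwise; each term dies because
  \<open>chi\<close> vanishes or the exponent is not congruent to \<open>i\<close>.\<close>

lemma partial_theta_filter:
  assumes "\<nu> \<in> {0, 1}" "a \<ge> 0" "b > 0" "\<And>n. norm (chi n) \<le> B" "0 < norm x" "norm x < 1"
    and "i < s" "i \<notin> S_set a b chi s"
  defines "\<omega> \<equiv> cis (2 * pi / of_nat s)"
  shows "(\<Sum>k<s. (\<omega> powi (- int i)) ^ k * partial_theta \<nu> a b chi (\<omega> ^ k * x)) = 0"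
proof -
  define u where "u = (\<lambda>k n. of_nat n ^ \<nu> * chi (int n) * (\<omega> ^ k * x) powi theta_exp a b (int n))"
  have sm: "summable (u k)" for k
    unfolding u_def by (rule summable_partial_theta[OF assms(1-4)])
      (use assms in \<open>auto simp: norm_mult norm_power\<close>)
  have "partial_theta \<nu> a b chi (\<omega> ^ k * x) = suminf (u k)" for k
    by (simp add: partial_theta_def u_def)
  then have "(\<Sum>k<s. (\<omega> powi (- int i)) ^ k * partial_theta \<nu> a b chi (\<omega> ^ k * x))
      = (\<Sum>n. \<Sum>k<s. (\<omega> powi (- int i)) ^ k * u k n)"
    using sm by (subst suminf_sum) (simp_all add: suminf_mult summable_mult)
  also have "\<dots> = 0"
  proof -
    have "(\<Sum>k<s. (\<omega> powi (- int i)) ^ k * u k n) = 0" for n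
    proof (cases "chi (int n) = 0")
      case False
      let ?e = "theta_exp a b (int n)"
      have "\<not> int s dvd ?e - int i"
      proof
        assume "int s dvd ?e - int i"
        then have "?e mod int s = int i"
          using assms(7) by (metis mod_eq_dvd_iff mod_less zmod_int)
        then have "i = nat (?e mod int s)" by simp
        then show False using assms(8) False unfolding S_set_def by blast
      qed
      then have "(\<Sum>k<s. (\<omega> powi (- int i)) ^ k * (\<omega> ^ k * x) powi ?e) = 0"
        using power_root_of_unity_filter[of s x "int i" ?e] assms(5,7) by (auto simp: \<omega>_def)
      moreover have "(\<Sum>k<s. (\<omega> powi (- int i)) ^ k * u k n)
          = (of_nat n ^ \<nu> * chi (int n)) * (\<Sum>k<s. (\<omega> powi (- int i)) ^ k * (\<omega> ^ k * x) powi ?e)"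
        unfolding u_def sum_distrib_left by (simp add: mult_ac)
      ultimately show ?thesis by simp
    qed (simp add: u_def)
    then show ?thesis by simp
  qed
  finally show ?thesis .
qed

lemma periodic_bounded:
  fixes g :: "int \<Rightarrow> 'a::real_normed_vector"
  assumes "M > 0" "\<And>n. g (n + M) = g n"
  obtains B where "\<And>n. norm (g n) \<le> B"
proof
  fix n
  have "g (n + M * int k) = g n" for n k
  proof (induction k)
    case (Suc k)
    then show ?case using assms(2)[of "n + M * int k"] by (simp add: distrib_left add_ac)
  qed simp
  then have up: "g (n + M * j) = g n" if "j \<ge> 0" for n j
    using that by (metis nonneg_int_cases)
  have "g (n mod M) = g n"
  proof (cases "n div M \<ge> 0")
    case True
    then show ?thesis using up[of "n div M" "n mod M"] by simp
  next
    \<comment> \<open>With a negative quotient, the forward shifts lead from \<open>n\<close> up to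
      \<open>n mod M\<close> instead.\<close>
    case False
    then show ?thesis using up[of "- (n div M)" n]
      by (simp add: minus_mult_div_eq_mod)
  qed
  moreover have "norm (g (n mod M)) \<le> (\<Sum>n\<in>{0..<M}. norm (g n))"
    using assms(1) by (intro member_le_sum) auto
  ultimately show "norm (g n) \<le> (\<Sum>n\<in>{0..<M}. norm (g n))" by simp
qed


theorem theorem1p2:
  fixes f :: "nat \<Rightarrow> complex poly"
    and \<nu> s N i :: nat
    and a b :: int
    and chi :: "int \<Rightarrow> complex"
  assumes "\<nu> \<in> {0, 1}" and "a \<ge> 0" and "b > 0"
    and "\<And>n. chi n \<noteq> 0 \<Longrightarrow> b dvd n\<^sup>2 - a"
    and "\<And>\<zeta>. root_of_unity \<zeta> \<Longrightarrow> periodic_mean_zero (\<lambda>n. \<zeta> powi theta_exp a b n * chi n)"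
    and "\<And>\<zeta>. root_of_unity \<zeta> \<Longrightarrow>
           has_expansion_at_0 (\<lambda>t. partial_theta \<nu> a b chi (\<zeta> * of_real (exp (- t)))) (F_series f \<zeta>)"
    and "s > 0" and "N > 0" and "i < s" and "i \<notin> S_set a b chi s"
  shows "qq_poly ((N + 1) div s) dvd A_F f s N i"
proof (cases "A_F f s N i = 0")
  case False
  define \<omega> where "\<omega> = cis (2 * pi / of_nat s)"
  have \<omega>: "\<omega> ^ s = 1"
    using assms(7) by (simp add: \<omega>_def Complex.DeMoivre)
  \<comment> \<open>The periodicity hypothesis at 1 concerns \<open>chi\<close> itself and so makes
    \<open>chi\<close> bounded.\<close>
  have "root_of_unity 1" unfolding root_of_unity_def by (intro exI[of _ 1]) simp
  then obtain T where "T > 0" "\<And>n. chi (n + T) = chi n"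
    using assms(5)[of 1] by (auto simp: periodic_mean_zero_def)
  then obtain B where B: "\<And>n. norm (chi n) \<le> B"
    by (rule periodic_bounded[of T chi]) auto
  \<comment> \<open>The analytic input: the filtered theta function is identically zero for
    \<open>t > 0\<close>, hence so is its expansion, coefficient by coefficient.\<close>
  have series: "(\<Sum>k<s. (\<omega> powi (- int i)) ^ k * F_deriv f (\<omega> ^ k * \<zeta>) l) = 0"
    if \<zeta>: "root_of_unity \<zeta>" for \<zeta> l
  proof -
    obtain m where m: "m > 0" "\<zeta> ^ m = 1" using \<zeta> by (auto simp: root_of_unity_def)
    have "norm \<zeta> ^ m = 1" using m(2) by (simp flip: norm_power)
    then have norm_\<zeta>: "norm \<zeta> = 1" using m(1) power_eq_imp_eq_base[of "norm \<zeta>" m 1] by simp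
    have "root_of_unity (\<omega> ^ k * \<zeta>)" for k
    proof -
      have "(\<omega> ^ k * \<zeta>) ^ (s * m) = (\<omega> ^ s) ^ (k * m) * (\<zeta> ^ m) ^ s"
        by (simp only: power_mult_distrib mult_ac flip: power_mult)
      then show ?thesis unfolding root_of_unity_def using m assms(7) \<omega>
        by (intro exI[of _ "s * m"]) simp
    qed
    then have "has_expansion_at_0
        (\<lambda>t. \<Sum>k<s. (\<omega> powi (- int i)) ^ k * partial_theta \<nu> a b chi (\<omega> ^ k * \<zeta> * of_real (exp (- t))))
        (\<Sum>k<s. fps_const ((\<omega> powi (- int i)) ^ k) * F_series f (\<omega> ^ k * \<zeta>))"
      by (intro has_expansion_at_0_sum assms(6)) auto
    moreover have "(\<Sum>k<s. (\<omega> powi (- int i)) ^ k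
        * partial_theta \<nu> a b chi (\<omega> ^ k * \<zeta> * of_real (exp (- t)))) = 0" if "t > 0" for t
      using partial_theta_filter[OF assms(1-3) B _ _ assms(9,10), of "\<zeta> * of_real (exp (- t))"] that
        norm_\<zeta> by (simp add: \<omega>_def norm_mult mult.assoc)
    ultimately have "(\<Sum>k<s. fps_const ((\<omega> powi (- int i)) ^ k) * F_series f (\<omega> ^ k * \<zeta>)) = 0"
      by (rule has_expansion_at_0_unique)
    then have "fps_nth (\<Sum>k<s. fps_const ((\<omega> powi (- int i)) ^ k) * F_series f (\<omega> ^ k * \<zeta>)) l = 0"
      by (simp only: fps_zero_nth)
    then have "(\<Sum>k<s. (\<omega> powi (- int i)) ^ k * F_deriv f (\<omega> ^ k * \<zeta>) l / fact l) = 0"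
      by (simp add: F_series_def fps_sum_nth)
    then show ?thesis by (simp flip: sum_divide_distrib)
  qed
  show ?thesis
  proof (rule poly_dvd_if_order_le[OF qq_poly_neq_0 False])
    fix \<eta>
    show "order \<eta> (qq_poly ((N + 1) div s)) \<le> order \<eta> (A_F f s N i)"
    proof (cases "poly (qq_poly ((N + 1) div s)) \<eta> = 0")
      case True
      then obtain k where "\<eta> ^ Suc k = 1" by (auto simp: q_poch_def poly_prod)
      then have ex: "\<exists>m>0. \<eta> ^ m = 1" by blast
      \<comment> \<open>The multiplicative order of \<eta>, which is a root of unity because some
        factor of the \<open>q\<close>-factorial vanishes there.\<close>
      define m where "m = (LEAST m. m > 0 \<and> \<eta> ^ m = 1)"
      have m: "m > 0" "\<eta> ^ m = 1" using LeastI_ex[OF ex] by (auto simp: m_def)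
      have m_dvd: "m dvd n" if "\<eta> ^ n = 1" for n
      proof -
        have "\<eta> ^ n = \<eta> ^ (m * (n div m)) * \<eta> ^ (n mod m)" by (simp flip: power_add)
        then have "\<eta> ^ (n mod m) = 1" using that m(2) by (simp add: power_mult)
        then have "n mod m = 0"
          using not_less_Least[of "n mod m" "\<lambda>m. m > 0 \<and> \<eta> ^ m = 1"] m(1)
          by (auto simp flip: m_def)
        then show ?thesis by auto
      qed
      have \<eta>0: "\<eta> \<noteq> 0" using m by (auto simp: power_0_left)
      obtain \<zeta> where \<zeta>: "\<zeta> ^ s = \<eta>" using nth_root_exists assms(7) by blast
      have \<zeta>0: "\<zeta> \<noteq> 0" using \<zeta> \<eta>0 assms(7) by auto
      have sm: "s * m > 0" "(\<omega> ^ k * \<zeta>) ^ (s * m) = 1" for k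
      proof -
        have "(\<omega> ^ k * \<zeta>) ^ (s * m) = (\<omega> ^ s) ^ (k * m) * (\<zeta> ^ s) ^ m"
          by (simp only: power_mult_distrib mult_ac flip: power_mult)
        then show "(\<omega> ^ k * \<zeta>) ^ (s * m) = 1" using m \<omega> \<zeta> by simp
      qed (use m assms(7) in simp)
      then have root: "root_of_unity \<zeta>"
        unfolding root_of_unity_def using sm(2)[of 0] by (intro exI[of _ "s * m"]) simp
      define M where "M = (N + 1) div s div m"
      let ?A = "monom 1 i * pcompose (A_F f s N i) (monom 1 s)"
      have "[:- \<zeta>, 1:] ^ M dvd ?A"
      proof (rule linear_power_dvd_if_neg_euler[OF \<zeta>0])
        fix l assume "l < M"
        \<comment> \<open>As \<open>M\<close> equals \<open>(N + 1) div (s * m)\<close>, the bound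
          \<open>l < M\<close> gives exactly the stabilisation threshold of
          \<open>F_deriv_eq\<close> for \<open>s * m\<close>-th roots of unity.\<close>
        then have "s * m * (l + 1) \<le> s * m * ((N + 1) div (s * m))"
          unfolding M_def div_mult2_eq by (intro mult_le_mono2) simp
        also have "\<dots> \<le> N + 1" by simp
        finally have "N \<ge> s * m * (l + 1) - 1" by simp
        then have "F_deriv f (\<omega> ^ k * \<zeta>) l = F_trunc_deriv f (\<omega> ^ k * \<zeta>) N l" for k
          by (rule F_deriv_eq[OF sm])
        then have "of_nat s * poly ((neg_euler ^^ l) ?A) \<zeta> = 0"
          using series[OF root, of l] dissection_part_filter[OF assms(9) \<zeta>0, of l "F_trunc f N"]
          by (simp add: F_trunc_deriv_eq A_F_def \<omega>_def)
        then show "poly ((neg_euler ^^ l) ?A) \<zeta> = 0" using assms(7) by simp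
      qed
      then have "[:- \<eta>, 1:] ^ M dvd A_F f s N i"
        using linear_power_dvd_of_pcompose[OF \<zeta>0 assms(7)] \<zeta> by blast
      then have "M \<le> order \<eta> (A_F f s N i)" using False by (simp add: order_divides)
      then show ?thesis
        using order_qq_poly_le[OF m(1) \<eta>0 m_dvd, of "(N + 1) div s"] unfolding M_def by linarith
    qed (simp add: order_0I)
  qed
qed simp

end
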